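(* Every computable graph $G$ has a computable copy (a computable graph isomorphic to $G$) in which the set of isolated vertices is computable.
   Context: A graph is a set of vertices $V\subseteq\mathbb{N}$ with an irreflexive symmetric edge relation; it is computable if $V$ and the edge relation are computable. A vertex is isolated if it has no neighbors. *)

theory Defs
  imports Main
begin

text \<open>Computability on the natural numbers is defined via partial recursive (mu-recursive)
  functions. Terms carry no arity: for each n, a term denotes an n-ary partial recursive function,
  with the empty domain where the shapes do not match. In \<open>PrimRec\<close> and \<open>Mu\<close> the recursion
  (respectively search) variable is the first argument.\<close>

datatype recf =
    Zero
  | Succ
  | Proj nat
  | Comp recf "recf list"
  | PrimRec recf recf
  | Mu recf

text \<open>\<open>evaluates f xs y\<close>: the function denoted by \<open>f\<close> converges on the arguments \<open>xs\<close>
  with value \<open>y\<close>.\<close>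

inductive evaluates :: "recf \<Rightarrow> nat list \<Rightarrow> nat \<Rightarrow> bool" where
  zero: "evaluates Zero xs 0"
| succ: "evaluates Succ [x] (Suc x)"
| proj: "i < length xs \<Longrightarrow> evaluates (Proj i) xs (xs ! i)"
| comp: "list_all2 (\<lambda>g y. evaluates g xs y) gs ys \<Longrightarrow> evaluates f ys z \<Longrightarrow>
    evaluates (Comp f gs) xs z"
| prim_0: "evaluates f xs y \<Longrightarrow> evaluates (PrimRec f g) (0 # xs) y"
| prim_Suc: "evaluates (PrimRec f g) (n # xs) r \<Longrightarrow> evaluates g (n # r # xs) y \<Longrightarrow>
    evaluates (PrimRec f g) (Suc n # xs) y"
| mu: "evaluates f (n # xs) 0 \<Longrightarrow> (\<And>m. m < n \<Longrightarrow> \<exists>k. evaluates f (m # xs) (Suc k)) \<Longrightarrow>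
    evaluates (Mu f) xs n"

inductive_cases evaluates_ZeroE: "evaluates Zero xs y"
inductive_cases evaluates_SuccE: "evaluates Succ xs y"
inductive_cases evaluates_ProjE: "evaluates (Proj i) xs y"
inductive_cases evaluates_CompE: "evaluates (Comp f gs) xs y"
inductive_cases evaluates_Prim0E: "evaluates (PrimRec f g) (0 # xs) y"
inductive_cases evaluates_PrimSucE: "evaluates (PrimRec f g) (Suc n # xs) y"
inductive_cases evaluates_MuE: "evaluates (Mu f) xs y"

lemma evaluates_functional:
  assumes "evaluates f xs y" "evaluates f xs z"
  shows "y = z"
  using assms
proof (induction arbitrary: z rule: evaluates.induct)
  case (zero xs)
  then show ?case by (rule evaluates_ZeroE) simp
next
  case (succ x)
  then show ?case by (rule evaluates_SuccE) simp
next
  case (proj i xs)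
  from proj.prems show ?case by (rule evaluates_ProjE) simp
next
  case (comp xs gs ys f y)
  from comp.prems obtain ys' where 1: "list_all2 (\<lambda>g y. evaluates g xs y) gs ys'"
    and 2: "evaluates f ys' z"
    by (rule evaluates_CompE)
  have "ys = ys'"
  proof (rule nth_equalityI)
    show "length ys = length ys'"
      using list_all2_lengthD[OF comp.IH(1)] list_all2_lengthD[OF 1] by simp
    show "ys ! i = ys' ! i" if "i < length ys" for i
      using that list_all2_nthD2[OF comp.IH(1) that] list_all2_nthD[OF 1, of i]
        list_all2_lengthD[OF comp.IH(1)] by metis
  qed
  with 2 show ?case by (simp add: comp.IH(2))
next
  case (prim_0 f xs y g)
  from prim_0.prems have "evaluates f xs z" by (rule evaluates_Prim0E)
  then show ?case by (rule prim_0.IH)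
next
  case (prim_Suc f g n xs r y)
  from prim_Suc.prems obtain r' where
    1: "evaluates (PrimRec f g) (n # xs) r'" and 2: "evaluates g (n # r' # xs) z"
    by (rule evaluates_PrimSucE)
  from prim_Suc.IH(1)[OF 1] 2 show ?case by (intro prim_Suc.IH(2)) simp
next
  case (mu f n xs)
  from mu.prems have 0: "evaluates f (z # xs) 0"
    and less: "\<And>m. m < z \<Longrightarrow> \<exists>k. evaluates f (m # xs) (Suc k)"
    by (rule evaluates_MuE, blast)+
  have "\<not> n < z" using mu.IH(1) less by (metis nat.distinct(1))
  moreover have "\<not> z < n" using mu.IH(2) 0 by (metis nat.distinct(1))
  ultimately show ?case by simp
qed

definition computable_set :: "nat set \<Rightarrow> bool" where
  "computable_set A \<longleftrightarrow> (\<exists>f. \<forall>x. evaluates f [x] (of_bool (x \<in> A)))"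

definition computable_rel :: "(nat \<times> nat) set \<Rightarrow> bool" where
  "computable_rel R \<longleftrightarrow> (\<exists>f. \<forall>x y. evaluates f [x, y] (of_bool ((x, y) \<in> R)))"

definition nat_graph :: "nat set \<Rightarrow> (nat \<times> nat) set \<Rightarrow> bool" where
  "nat_graph V E \<longleftrightarrow> E \<subseteq> V \<times> V \<and> irrefl E \<and> sym E"

definition computable_graph :: "nat set \<Rightarrow> (nat \<times> nat) set \<Rightarrow> bool" where
  "computable_graph V E \<longleftrightarrow> nat_graph V E \<and> computable_set V \<and> computable_rel E"

definition graph_isomorphic ::
    "nat set \<Rightarrow> (nat \<times> nat) set \<Rightarrow> nat set \<Rightarrow> (nat \<times> nat) set \<Rightarrow> bool" where
  "graph_isomorphic V E V' E' \<longleftrightarrow>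
    (\<exists>h. bij_betw h V V' \<and> (\<forall>x\<in>V. \<forall>y\<in>V. (x, y) \<in> E \<longleftrightarrow> (h x, h y) \<in> E'))"

definition isolated_vertices :: "nat set \<Rightarrow> (nat \<times> nat) set \<Rightarrow> nat set" where
  "isolated_vertices V E = {v \<in> V. \<forall>w\<in>V. (v, w) \<notin> E}"

end

(*
  The copy has vertices pair(v, w + 1), where v is a non-isolated vertex of G and w is the least
  neighbour of v, together with vertices pair(k, 0), one for each isolated vertex of G.  Whether
  w is the least neighbour of v is decided by a bounded search, so the first kind of vertices is a
  computable set although the set of non-isolated vertices of G is only computably enumerable.
  The set K of the numbers k can be taken to be an initial segment of the natural numbers, hence
  computable.
*)

theory Submission
  imports Defs "HOL-Library.Infinite_Set" "HOL-Library.Nat_Bijection"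
begin

section \<open>Closure properties of computable functions\<close>

text \<open>Arguments form one list and only lists of length \<open>k\<close> are constrained. In
  this shape each closure property below is an introduction rule for a lambda term in
  \<open>xs\<close>, and computability proofs follow the syntax of the term.\<close>

definition computable_fun :: "nat \<Rightarrow> (nat list \<Rightarrow> nat) \<Rightarrow> bool" where
  "computable_fun k F \<longleftrightarrow> (\<exists>f. \<forall>xs. length xs = k \<longrightarrow> evaluates f xs (F xs))"

definition computable_pred :: "nat \<Rightarrow> (nat list \<Rightarrow> bool) \<Rightarrow> bool" where
  "computable_pred k P \<longleftrightarrow> computable_fun k (\<lambda>xs. of_bool (P xs))"

lemma computable_fun_cong:
  assumes "computable_fun k F" "\<And>xs. length xs = k \<Longrightarrow> F xs = G xs"
  shows "computable_fun k G"
  using assms unfolding computable_fun_def by metis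

lemma computable_pred_cong:
  assumes "computable_pred k P" "\<And>xs. length xs = k \<Longrightarrow> P xs = Q xs"
  shows "computable_pred k Q"
  using assms unfolding computable_pred_def by (auto elim: computable_fun_cong)

lemma computable_fun_nth: "i < k \<Longrightarrow> computable_fun k (\<lambda>xs. xs ! i)"
  unfolding computable_fun_def by (rule exI[of _ "Proj i"]) (auto intro: evaluates.proj)

lemma computable_fun_comp:
  assumes "computable_fun m F" "length Gs = m" "\<And>G. G \<in> set Gs \<Longrightarrow> computable_fun k G"
  shows "computable_fun k (\<lambda>xs. F (map (\<lambda>G. G xs) Gs))"
proof -
  obtain f where f: "\<And>ys. length ys = m \<Longrightarrow> evaluates f ys (F ys)"
    using assms(1) unfolding computable_fun_def by auto
  have "\<forall>G\<in>set Gs. \<exists>g. \<forall>xs. length xs = k \<longrightarrow> evaluates g xs (G xs)"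
    using assms(3) unfolding computable_fun_def by blast
  then obtain c where c: "\<And>G xs. G \<in> set Gs \<Longrightarrow> length xs = k \<Longrightarrow> evaluates (c G) xs (G xs)"
    by metis
  have "evaluates (Comp f (map c Gs)) xs (F (map (\<lambda>G. G xs) Gs))" if "length xs = k" for xs
    using assms(2) c that
    by (intro evaluates.comp[where ys = "map (\<lambda>G. G xs) Gs"] f)
      (auto simp: list_all2_map1 list_all2_map2 intro: list.rel_refl_strong)
  then show ?thesis unfolding computable_fun_def by blast
qed

lemma computable_fun_comp1:
  assumes "computable_fun 1 F" "computable_fun k G"
  shows "computable_fun k (\<lambda>xs. F [G xs])"
  using computable_fun_comp[OF assms(1), of "[G]" k] assms(2) by simp

lemma computable_fun_comp2:
  assumes "computable_fun 2 F" "computable_fun k G" "computable_fun k H"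
  shows "computable_fun k (\<lambda>xs. F [G xs, H xs])"
  using computable_fun_comp[OF assms(1), of "[G, H]" k] assms(2,3) by auto

lemma computable_fun_0: "computable_fun k (\<lambda>xs. 0)"
  unfolding computable_fun_def by (blast intro: evaluates.zero)

lemma computable_fun_Suc:
  assumes "computable_fun k F"
  shows "computable_fun k (\<lambda>xs. Suc (F xs))"
proof -
  have "evaluates Succ xs (Suc (xs ! 0))" if "length xs = 1" for xs
    using that evaluates.succ[of "xs ! 0"] by (cases xs) auto
  then have "computable_fun 1 (\<lambda>xs. Suc (xs ! 0))"
    unfolding computable_fun_def by blast
  from computable_fun_comp1[OF this assms] show ?thesis by simp
qed

lemma computable_fun_const: "computable_fun k (\<lambda>xs. c)"
  by (induction c) (auto intro: computable_fun_0 computable_fun_Suc)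

lemma computable_fun_rec_hd:
  assumes "computable_fun k A" "computable_fun (Suc (Suc k)) B"
  shows "computable_fun (Suc k)
    (\<lambda>xs. rec_nat (A (tl xs)) (\<lambda>n r. B (n # r # tl xs)) (hd xs))"
proof -
  obtain a b where a: "\<And>xs. length xs = k \<Longrightarrow> evaluates a xs (A xs)"
    and b: "\<And>xs. length xs = Suc (Suc k) \<Longrightarrow> evaluates b xs (B xs)"
    using assms unfolding computable_fun_def by auto
  have *: "evaluates (PrimRec a b) (n # xs) (rec_nat (A xs) (\<lambda>n r. B (n # r # xs)) n)"
    if "length xs = k" for n xs
    using that by (induction n) (auto intro: evaluates.prim_0 a evaluates.prim_Suc[OF _ b])
  have "evaluates (PrimRec a b) xs (rec_nat (A (tl xs)) (\<lambda>n r. B (n # r # tl xs)) (hd xs))"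
    if "length xs = Suc k" for xs
    using *[of "tl xs" "hd xs"] that by (cases xs) auto
  then show ?thesis unfolding computable_fun_def by blast
qed

text \<open>Composing with \<open>F\<close> followed by all projections turns recursion on the first
  argument into recursion of depth \<open>F xs\<close> with all of \<open>xs\<close> as parameters.
  Arithmetic and bounded search both use this form.\<close>

lemma computable_fun_rec:
  assumes "computable_fun k A" "computable_fun (Suc (Suc k)) B" "computable_fun k F"
  shows "computable_fun k (\<lambda>xs. rec_nat (A xs) (\<lambda>n r. B (n # r # xs)) (F xs))"
proof (rule computable_fun_cong)
  let ?Gs = "F # map (\<lambda>i xs. xs ! i) [0..<k]"
  let ?R = "\<lambda>xs. rec_nat (A (tl xs)) (\<lambda>n r. B (n # r # tl xs)) (hd xs)"
  show "computable_fun k (\<lambda>xs. ?R (map (\<lambda>G. G xs) ?Gs))"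
    by (rule computable_fun_comp[OF computable_fun_rec_hd[OF assms(1,2)]])
      (auto intro: assms(3) computable_fun_nth)
  show "?R (map (\<lambda>G. G xs) ?Gs) = rec_nat (A xs) (\<lambda>n r. B (n # r # xs)) (F xs)"
    if "length xs = k" for xs
    using that[symmetric] by (simp add: comp_def map_nth)
qed

section \<open>Arithmetic and the pairing function\<close>

lemma computable_fun_add:
  assumes "computable_fun k F" "computable_fun k G"
  shows "computable_fun k (\<lambda>xs. F xs + G xs)"
proof -
  \<comment> \<open>In a recursion step, position 0 holds the counter, position 1 the previous
    value, and the parameters follow.\<close>
  have B: "computable_fun (Suc (Suc k)) (\<lambda>ys. Suc (ys ! 1))"
    by (intro computable_fun_Suc computable_fun_nth) simp
  have "rec_nat x (\<lambda>n r. Suc ((n # r # zs) ! 1)) y = x + y" for x y and zs :: "nat list"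
    by (induction y) auto
  with computable_fun_rec[OF assms(1) B assms(2)] show ?thesis by (simp only:)
qed

lemma computable_fun_pred:
  assumes "computable_fun k F"
  shows "computable_fun k (\<lambda>xs. F xs - 1)"
proof -
  \<comment> \<open>The step returns the counter, so depth \<open>Suc n\<close> gives
    \<open>n\<close>; depth 0 gives the base value 0.\<close>
  have B: "computable_fun (Suc (Suc k)) (\<lambda>ys. ys ! 0)"
    by (intro computable_fun_nth) simp
  have "rec_nat 0 (\<lambda>n r. (n # r # zs) ! 0) y = y - 1" for y and zs :: "nat list"
    by (cases y) auto
  with computable_fun_rec[OF computable_fun_0 B assms] show ?thesis by (simp only:)
qed

lemma computable_fun_diff:
  assumes "computable_fun k F" "computable_fun k G"
  shows "computable_fun k (\<lambda>xs. F xs - G xs)"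
proof -
  have B: "computable_fun (Suc (Suc k)) (\<lambda>ys. ys ! 1 - 1)"
    by (intro computable_fun_pred computable_fun_nth) simp
  have "rec_nat x (\<lambda>n r. (n # r # zs) ! 1 - 1) y = x - y" for x y and zs :: "nat list"
    by (induction y) auto
  with computable_fun_rec[OF assms(1) B assms(2)] show ?thesis by (simp only:)
qed

text \<open>Needed for pairing, since \<open>prod_encode (m, n)\<close> is
  \<open>triangle (m + n) + m\<close>.\<close>

lemma computable_fun_triangle:
  assumes "computable_fun k F"
  shows "computable_fun k (\<lambda>xs. triangle (F xs))"
proof -
  have B: "computable_fun (Suc (Suc k)) (\<lambda>ys. ys ! 1 + Suc (ys ! 0))"
    by (intro computable_fun_add computable_fun_Suc computable_fun_nth) auto
  have "rec_nat 0 (\<lambda>n r. (n # r # zs) ! 1 + Suc ((n # r # zs) ! 0)) y = triangle y"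
    for y and zs :: "nat list"
    by (induction y) auto
  with computable_fun_rec[OF computable_fun_0 B assms] show ?thesis by (simp only:)
qed

lemma computable_fun_prod_encode:
  assumes "computable_fun k F" "computable_fun k G"
  shows "computable_fun k (\<lambda>xs. prod_encode (F xs, G xs))"
  unfolding prod_encode_def prod.case
  by (intro computable_fun_add computable_fun_triangle assms)

section \<open>Closure properties of computable predicates\<close>

text \<open>Truncated subtraction makes \<open>1 - n\<close> the characteristic function of
  \<open>n = 0\<close>. The Boolean connectives and comparisons below reduce to this zero
  test.\<close>

lemma computable_pred_eq_0:
  assumes "computable_fun k F"
  shows "computable_pred k (\<lambda>xs. F xs = 0)"
proof -
  have "computable_fun k (\<lambda>xs. 1 - F xs)"
    by (intro computable_fun_diff computable_fun_const assms)
  moreover have "1 - n = of_bool (n = 0)" for n :: nat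
    by (cases n) auto
  ultimately show ?thesis unfolding computable_pred_def by simp
qed

lemma computable_pred_not:
  assumes "computable_pred k P"
  shows "computable_pred k (\<lambda>xs. \<not> P xs)"
  using computable_pred_eq_0[OF assms[unfolded computable_pred_def]] by simp

text \<open>The sum of the characteristic functions of the two negations vanishes exactly when both
  conjuncts hold.\<close>

lemma computable_pred_conj:
  assumes "computable_pred k P" "computable_pred k Q"
  shows "computable_pred k (\<lambda>xs. P xs \<and> Q xs)"
  using computable_pred_eq_0[OF computable_fun_add[OF
      computable_pred_not[OF assms(1), unfolded computable_pred_def]
      computable_pred_not[OF assms(2), unfolded computable_pred_def]]]
  by simp

lemma computable_pred_disj:
  assumes "computable_pred k P" "computable_pred k Q"
  shows "computable_pred k (\<lambda>xs. P xs \<or> Q xs)"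
  using computable_pred_not[OF computable_pred_conj[OF assms[THEN computable_pred_not]]] by simp

lemma computable_pred_less:
  assumes "computable_fun k F" "computable_fun k G"
  shows "computable_pred k (\<lambda>xs. F xs < G xs)"
  using computable_pred_not[OF computable_pred_eq_0[OF computable_fun_diff[OF assms(2,1)]]]
  by (simp add: not_le)

lemma computable_pred_eq:
  assumes "computable_fun k F" "computable_fun k G"
  shows "computable_pred k (\<lambda>xs. F xs = G xs)"
  by (rule computable_pred_cong[OF computable_pred_conj[OF
        computable_pred_not[OF computable_pred_less[OF assms]]
        computable_pred_not[OF computable_pred_less[OF assms(2,1)]]]]) auto

text \<open>Primitive recursion on the bound, with the previous value recording whether a witness
  has been found. The bound variable is placed at the head of the list so that quantifiers can be
  nested.\<close>

lemma computable_pred_bex_less: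
  assumes P: "computable_pred (Suc k) (\<lambda>xs. P (hd xs) (tl xs))" and F: "computable_fun k F"
  shows "computable_pred k (\<lambda>xs. \<exists>i<F xs. P i xs)"
proof -
  \<comment> \<open>These projections skip position 1, the previous value, so that \<open>P\<close>
    receives the counter and the parameters only.\<close>
  let ?Gs = "(\<lambda>xs. xs ! 0) # map (\<lambda>i xs. xs ! Suc (Suc i)) [0..<k]"
  let ?Q = "\<lambda>xs. of_bool (P (hd xs) (tl xs))"
  have "computable_fun (Suc (Suc k)) (\<lambda>xs. ?Q (map (\<lambda>G. G xs) ?Gs))"
    by (rule computable_fun_comp[OF P[unfolded computable_pred_def]])
      (auto intro: computable_fun_nth)
  then have "computable_fun (Suc (Suc k)) (\<lambda>xs. of_bool (P (xs ! 0) (tl (tl xs))))"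
  proof (rule computable_fun_cong)
    show "?Q (map (\<lambda>G. G xs) ?Gs) = of_bool (P (xs ! 0) (tl (tl xs)))"
      if "length xs = Suc (Suc k)" for xs
    proof -
      have "map ((\<lambda>G. G xs) \<circ> (\<lambda>i xs. xs ! Suc (Suc i))) [0..<k] = tl (tl xs)"
        using that by (intro nth_equalityI) (auto simp: nth_tl)
      then show ?thesis by simp
    qed
  qed
  then have "computable_pred (Suc (Suc k)) (\<lambda>ys. P (ys ! 0) (tl (tl ys)))"
    by (simp add: computable_pred_def)
  \<comment> \<open>The second disjunct preserves a witness found at a smaller counter.\<close>
  then have "computable_pred (Suc (Suc k)) (\<lambda>ys. P (ys ! 0) (tl (tl ys)) \<or> ys ! 1 \<noteq> 0)"
    by (rule computable_pred_disj)
      (intro computable_pred_not computable_pred_eq_0 computable_fun_nth, simp)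
  then have B: "computable_fun (Suc (Suc k))
      (\<lambda>ys. of_bool (P (ys ! 0) (tl (tl ys)) \<or> ys ! 1 \<noteq> 0))"
    by (simp only: computable_pred_def)
  have "rec_nat 0 (\<lambda>n r. of_bool (P ((n # r # zs) ! 0) (tl (tl (n # r # zs))) \<or>
      (n # r # zs) ! 1 \<noteq> 0)) y = (of_bool (\<exists>i<y. P i zs) :: nat)" for y zs
    by (induction y) (auto simp: less_Suc_eq)
  with computable_fun_rec[OF computable_fun_0 B F] show ?thesis
    by (simp only: computable_pred_def)
qed

section \<open>Passage between predicates on lists and computable sets and relations\<close>

lemma computable_pred_set:
  assumes "computable_set A" "computable_fun k F"
  shows "computable_pred k (\<lambda>xs. F xs \<in> A)"
proof -
  obtain f where f: "evaluates f [x] (of_bool (x \<in> A))" for x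
    using assms(1) unfolding computable_set_def by blast
  have "evaluates f xs (of_bool (xs ! 0 \<in> A))" if "length xs = 1" for xs
    using f[of "xs ! 0"] that by (cases xs) auto
  then have "computable_fun 1 (\<lambda>xs. of_bool (xs ! 0 \<in> A))"
    unfolding computable_fun_def by blast
  from computable_fun_comp1[OF this assms(2)] show ?thesis by (simp add: computable_pred_def)
qed

lemma computable_pred_rel:
  assumes "computable_rel R" "computable_fun k F" "computable_fun k G"
  shows "computable_pred k (\<lambda>xs. (F xs, G xs) \<in> R)"
proof -
  obtain f where f: "evaluates f [x, y] (of_bool ((x, y) \<in> R))" for x y
    using assms(1) unfolding computable_rel_def by blast
  have "evaluates f xs (of_bool ((xs ! 0, xs ! 1) \<in> R))" if "length xs = 2" for xs
  proof -
    have "xs = [xs ! 0, xs ! 1]"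
      using that by (auto simp: length_Suc_conv numeral_2_eq_2)
    then show ?thesis using f by metis
  qed
  then have "computable_fun 2 (\<lambda>xs. of_bool ((xs ! 0, xs ! 1) \<in> R))"
    unfolding computable_fun_def by blast
  from computable_fun_comp2[OF this assms(2,3)] show ?thesis by (simp add: computable_pred_def)
qed

lemma computable_setI:
  assumes "computable_pred 1 (\<lambda>xs. xs ! 0 \<in> A)"
  shows "computable_set A"
proof -
  obtain f where f: "\<And>xs. length xs = 1 \<Longrightarrow> evaluates f xs (of_bool (xs ! 0 \<in> A))"
    using assms unfolding computable_pred_def computable_fun_def by auto
  have "evaluates f [x] (of_bool (x \<in> A))" for x
    using f[of "[x]"] by simp
  then show ?thesis unfolding computable_set_def by blast
qed

lemma computable_relI:
  assumes "computable_pred 2 (\<lambda>xs. (xs ! 0, xs ! 1) \<in> R)"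
  shows "computable_rel R"
proof -
  obtain f where f: "\<And>xs. length xs = 2 \<Longrightarrow> evaluates f xs (of_bool ((xs ! 0, xs ! 1) \<in> R))"
    using assms unfolding computable_pred_def computable_fun_def by auto
  have "evaluates f [x, y] (of_bool ((x, y) \<in> R))" for x y
    using f[of "[x, y]"] by simp
  then show ?thesis unfolding computable_rel_def by blast
qed

text \<open>Under a bounded quantifier the bound variable is \<open>hd\<close> and the outer
  arguments are read through \<open>tl\<close>; this rule and \<open>computable_fun_tl\<close>
  handle the two kinds of access.\<close>

lemma computable_fun_hd: "computable_fun (Suc k) hd"
  by (rule computable_fun_cong[OF computable_fun_nth[of 0]]) (auto simp: hd_conv_nth length_Suc_conv)

lemma computable_fun_tl:
  assumes "computable_fun k F"
  shows "computable_fun (Suc k) (\<lambda>xs. F (tl xs))"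
proof (rule computable_fun_cong)
  let ?Gs = "map (\<lambda>i xs. xs ! Suc i) [0..<k]"
  show "computable_fun (Suc k) (\<lambda>xs. F (map (\<lambda>G. G xs) ?Gs))"
    by (rule computable_fun_comp[OF assms]) (auto intro: computable_fun_nth)
  show "F (map (\<lambda>G. G xs) ?Gs) = F (tl xs)" if "length xs = Suc k" for xs
  proof -
    have "map ((\<lambda>G. G xs) \<circ> (\<lambda>i xs. xs ! Suc i)) [0..<k] = tl xs"
      using that by (intro nth_equalityI) (auto simp: nth_tl)
    then show ?thesis by simp
  qed
qed

text \<open>Decoding is replaced by bounded search: both components of a pair are at most its code,
  so only the computability of \<open>prod_encode\<close> enters.\<close>

lemma computable_pred_prod_decode:
  assumes P: "computable_pred 2 (\<lambda>xs. P (xs ! 0) (xs ! 1))" and F: "computable_fun k F"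
  shows "computable_pred k (\<lambda>xs. case prod_decode (F xs) of (v, u) \<Rightarrow> P v u)"
proof (rule computable_pred_cong)
  let ?Q = "\<lambda>xs. \<exists>v<Suc (F xs). \<exists>u<Suc (F xs). F xs = prod_encode (v, u) \<and> P v u"
  \<comment> \<open>Two quantifiers extend the list by two entries: the inner variable
    \<open>u\<close> first, then \<open>v\<close>.\<close>
  have "computable_pred (Suc (Suc k)) (\<lambda>xs. P (hd (tl xs)) (hd xs))"
    using computable_fun_comp2[OF P[unfolded computable_pred_def]
        computable_fun_tl[OF computable_fun_hd] computable_fun_hd]
    by (simp add: computable_pred_def)
  then show "computable_pred k ?Q"
    by (intro computable_pred_bex_less computable_pred_conj computable_pred_eq computable_fun_Suc
        computable_fun_prod_encode computable_fun_hd computable_fun_tl F)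
  show "?Q xs = (case prod_decode (F xs) of (v, u) \<Rightarrow> P v u)" for xs
  proof -
    obtain v u where vu: "prod_decode (F xs) = (v, u)" by fastforce
    then have eq: "F xs = prod_encode (v, u)" by (metis prod_decode_inverse)
    show ?thesis
      using le_prod_encode_1[of v u] le_prod_encode_2[of u v]
      by (auto simp: eq less_Suc_eq_le)
  qed
qed

section \<open>The copy\<close>

text \<open>Phrased with a bounded quantifier instead of \<open>LEAST\<close>, so that it is
  decidable from \<open>E\<close>, and false for every \<open>w\<close> when \<open>v\<close> has no
  neighbour.\<close>

definition least_neighbour :: "(nat \<times> nat) set \<Rightarrow> nat \<Rightarrow> nat \<Rightarrow> bool" where
  "least_neighbour E v w \<longleftrightarrow> (v, w) \<in> E \<and> \<not> (\<exists>i<w. (v, i) \<in> E)"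

text \<open>Together with \<open>least_neighbour_Least\<close>, this gives each non-isolated vertex
  exactly one counterpart in the copy.\<close>

lemma least_neighbour_unique: "least_neighbour E v w \<Longrightarrow> least_neighbour E v w' \<Longrightarrow> w = w'"
  unfolding least_neighbour_def by (metis linorder_neqE_nat)

lemma least_neighbour_Least: "(v, w) \<in> E \<Longrightarrow> least_neighbour E v (LEAST w. (v, w) \<in> E)"
  unfolding least_neighbour_def by (auto intro: LeastI dest: not_less_Least)

text \<open>A second component 0 marks an isolated vertex; a positive one stores the least neighbour
  shifted by one. For the empty relation only the codes of pairs \<open>(k, 0)\<close>
  remain.\<close>

definition copy_vertices :: "(nat \<times> nat) set \<Rightarrow> nat set \<Rightarrow> nat set" where
  "copy_vertices E K = {c. case prod_decode c of (v, u) \<Rightarrow>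
    u = 0 \<and> v \<in> K \<or> u \<noteq> 0 \<and> least_neighbour E v (u - 1)}"

text \<open>The two least-neighbour conditions confine the edges to vertices of the copy.\<close>

definition copy_edges :: "(nat \<times> nat) set \<Rightarrow> (nat \<times> nat) set" where
  "copy_edges E = {(c, d). \<exists>v w v' w'. c = prod_encode (v, Suc w) \<and> d = prod_encode (v', Suc w') \<and>
    least_neighbour E v w \<and> least_neighbour E v' w' \<and> (v, v') \<in> E}"

section \<open>Computability of the copy\<close>

lemma computable_pred_least_neighbour:
  assumes E: "computable_rel E" and F: "computable_fun k F" and G: "computable_fun k G"
  shows "computable_pred k (\<lambda>xs. least_neighbour E (F xs) (G xs))"
  unfolding least_neighbour_def
  by (intro computable_pred_conj computable_pred_rel[OF E] computable_pred_not
      computable_pred_bex_less computable_fun_hd computable_fun_tl F G)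

lemma computable_copy_vertices:
  assumes E: "computable_rel E" and K: "computable_set K"
  shows "computable_set (copy_vertices E K)"
proof (rule computable_setI)
  have "computable_pred 2 (\<lambda>xs. xs ! 1 = 0 \<and> xs ! 0 \<in> K \<or>
      xs ! 1 \<noteq> 0 \<and> least_neighbour E (xs ! 0) (xs ! 1 - 1))"
    by (intro computable_pred_disj computable_pred_conj computable_pred_not
        computable_pred_eq_0 computable_pred_set[OF K] computable_pred_least_neighbour[OF E]
        computable_fun_pred computable_fun_nth) auto
  from computable_pred_prod_decode[where P = "\<lambda>v u. u = 0 \<and> v \<in> K \<or>
      u \<noteq> 0 \<and> least_neighbour E v (u - 1)", OF this computable_fun_nth[of 0 1]]
  show "computable_pred 1 (\<lambda>xs. xs ! 0 \<in> copy_vertices E K)"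
    unfolding copy_vertices_def by simp
qed

text \<open>The four existential quantifiers can be bounded by the two codes, because components of
  a pair do not exceed its code.\<close>

lemma computable_copy_edges:
  assumes E: "computable_rel E"
  shows "computable_rel (copy_edges E)"
proof (rule computable_relI, rule computable_pred_cong)
  let ?Q = "\<lambda>xs. \<exists>v<Suc (xs ! 0). \<exists>w<Suc (xs ! 0). \<exists>v'<Suc (xs ! 1). \<exists>w'<Suc (xs ! 1).
    xs ! 0 = prod_encode (v, Suc w) \<and> xs ! 1 = prod_encode (v', Suc w') \<and>
    least_neighbour E v w \<and> least_neighbour E v' w' \<and> (v, v') \<in> E"
  show "computable_pred 2 ?Q"
    by (intro computable_pred_bex_less computable_pred_conj computable_pred_eq
        computable_pred_rel[OF E] computable_pred_least_neighbour[OF E]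
        computable_fun_prod_encode computable_fun_Suc computable_fun_hd computable_fun_tl
        computable_fun_nth) auto
  have bound: "v < Suc (prod_encode (v, Suc w))" "w < Suc (prod_encode (v, Suc w))" for v w
    using le_prod_encode_1[of v "Suc w"] le_prod_encode_2[of "Suc w" v] by auto
  show "?Q xs = ((xs ! 0, xs ! 1) \<in> copy_edges E)" for xs
    unfolding copy_edges_def by (auto intro: bound)
qed

section \<open>Graph structure, isolated vertices and isomorphism type of the copy\<close>

lemma prod_encode_0_in_copy_vertices [simp]:
  "prod_encode (k, 0) \<in> copy_vertices E K \<longleftrightarrow> k \<in> K"
  by (simp add: copy_vertices_def)

lemma prod_encode_Suc_in_copy_vertices [simp]:
  "prod_encode (v, Suc w) \<in> copy_vertices E K \<longleftrightarrow> least_neighbour E v w"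
  by (simp add: copy_vertices_def)

lemma copy_vertices_cases:
  assumes "c \<in> copy_vertices E K"
  obtains k where "c = prod_encode (k, 0)" "k \<in> K"
  | v w where "c = prod_encode (v, Suc w)" "least_neighbour E v w"
proof -
  obtain v u where c: "c = prod_encode (v, u)"
    by (metis prod_decode_inverse surj_pair)
  show ?thesis using that assms c by (cases u) auto
qed

lemma prod_encode_in_copy_edges [simp]:
  "(prod_encode (v, Suc w), prod_encode (v', Suc w')) \<in> copy_edges E \<longleftrightarrow>
    least_neighbour E v w \<and> least_neighbour E v' w' \<and> (v, v') \<in> E"
  "(prod_encode (k, 0), d) \<notin> copy_edges E"
  "(c, prod_encode (k, 0)) \<notin> copy_edges E"
  by (auto simp: copy_edges_def)

lemma nat_graph_copy:
  assumes "irrefl E" "sym E"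
  shows "nat_graph (copy_vertices E K) (copy_edges E)"
proof -
  have "sym (copy_edges E)"
    using assms(2) by (auto simp: copy_edges_def sym_def)
  moreover have "irrefl (copy_edges E)"
    using assms(1) by (auto simp: copy_edges_def irrefl_def)
  moreover have "copy_edges E \<subseteq> copy_vertices E K \<times> copy_vertices E K"
    by (auto simp: copy_edges_def)
  ultimately show ?thesis by (simp add: nat_graph_def)
qed

text \<open>No edge of the copy meets a code with second component 0, while a code of
  \<open>(v, Suc w)\<close> is adjacent to the counterpart of \<open>w\<close>.\<close>

lemma isolated_copy:
  assumes "sym E"
  shows "isolated_vertices (copy_vertices E K) (copy_edges E) = {prod_encode (k, 0) |k. k \<in> K}"
proof (intro subset_antisym subsetI)
  fix c assume c: "c \<in> isolated_vertices (copy_vertices E K) (copy_edges E)"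
  then have "c \<in> copy_vertices E K" by (simp add: isolated_vertices_def)
  then show "c \<in> {prod_encode (k, 0) |k. k \<in> K}"
  proof (cases rule: copy_vertices_cases)
    case (2 v w)
    then have vw: "(v, w) \<in> E" by (simp add: least_neighbour_def)
    then have "(w, v) \<in> E" using assms by (meson symD)
    \<comment> \<open>By symmetry \<open>w\<close> has the neighbour \<open>v\<close>, hence also a
      least one, which supplies the tag of its counterpart.\<close>
    then obtain u where "least_neighbour E w u" using least_neighbour_Least by blast
    then have "(c, prod_encode (w, Suc u)) \<in> copy_edges E"
      "prod_encode (w, Suc u) \<in> copy_vertices E K"
      using 2 vw by auto
    with c show ?thesis by (auto simp: isolated_vertices_def)
  qed auto
qed (auto simp: isolated_vertices_def)

text \<open>An isomorphism may be noncomputable, so it can be defined by cases on being isolated: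
  \<open>b\<close> numbers the isolated vertices, and every other vertex is tagged with its least
  neighbour.\<close>

lemma copy_isomorphic:
  assumes G: "nat_graph V E" and b: "bij_betw b (isolated_vertices V E) K"
  shows "graph_isomorphic V E (copy_vertices E K) (copy_edges E)"
proof -
  let ?I = "isolated_vertices V E"
  \<comment> \<open>Meaningful only for non-isolated \<open>v\<close>; \<open>h\<close> uses it only
    there.\<close>
  define l where "l v = (LEAST w. (v, w) \<in> E)" for v
  define h where "h v = (if v \<in> ?I then prod_encode (b v, 0) else prod_encode (v, Suc (l v)))" for v
  have l: "least_neighbour E v (l v)" if "v \<in> V - ?I" for v
    using that least_neighbour_Least unfolding l_def isolated_vertices_def by blast
  have I: "v \<notin> ?I \<and> v \<in> V" if "(v, w) \<in> E \<or> (w, v) \<in> E" for v w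
    using that G unfolding nat_graph_def isolated_vertices_def sym_def by blast
  have "bij_betw h V (copy_vertices E K)"
  proof (rule bij_betwI')
    show "h x = h y \<longleftrightarrow> x = y" if "x \<in> V" "y \<in> V" for x y
      using b by (auto simp: h_def bij_betw_def dest: inj_onD)
    show "h x \<in> copy_vertices E K" if "x \<in> V" for x
      using that b l by (auto simp: h_def bij_betw_def)
    show "\<exists>x\<in>V. c = h x" if "c \<in> copy_vertices E K" for c
      using that
    proof (cases rule: copy_vertices_cases)
      case (1 k)
      then obtain x where "x \<in> ?I" "b x = k" using b by (auto simp: bij_betw_def)
      with 1 show ?thesis by (auto simp: h_def isolated_vertices_def)
    next
      case (2 v w)
      then have v: "v \<in> V" "v \<notin> ?I" using I by (auto simp: least_neighbour_def)
      then have "l v = w" using 2 l least_neighbour_unique by blast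
      with 2 v show ?thesis by (auto simp: h_def)
    qed
  qed
  \<comment> \<open>If \<open>x\<close> or \<open>y\<close> is isolated, both sides are false, by
    \<open>I\<close> and by the tag 0. Otherwise both tags are correct and the right side reduces to
    \<open>(x, y) \<in> E\<close>.\<close>
  moreover have "(x, y) \<in> E \<longleftrightarrow> (h x, h y) \<in> copy_edges E" if "x \<in> V" "y \<in> V" for x y
    using that l I by (auto simp: h_def)
  ultimately show ?thesis unfolding graph_isomorphic_def by blast
qed

text \<open>Take an initial segment of length \<open>card A\<close> for finite \<open>A\<close>, and
  all of the natural numbers otherwise. The bijection need not be effective, and
  \<open>card A\<close> enters the decision procedure as a constant.\<close>

lemma bij_betw_computable_set:
  fixes A :: "nat set"
  obtains b K where "computable_set K" "bij_betw b A K"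
proof (cases "finite A")
  case True
  then obtain b where "bij_betw b A {0..<card A}"
    using ex_bij_betw_finite_nat by blast
  moreover have "computable_set {0..<card A}"
    by (rule computable_setI)
      (auto intro: computable_pred_less computable_fun_nth computable_fun_const)
  ultimately show ?thesis using that by blast
next
  case False
  \<comment> \<open>The constantly true predicate, which decides \<open>UNIV\<close>.\<close>
  have "computable_pred 1 (\<lambda>xs. 0 = (0::nat))"
    by (intro computable_pred_eq_0 computable_fun_0)
  then have "computable_set UNIV" by (intro computable_setI) simp
  moreover obtain b where "bij_betw b A (UNIV :: nat set)"
    using bij_betw_inv_into[OF bij_enumerate[OF False]] by blast
  ultimately show ?thesis using that by blast
qed

theorem theorem3p3:
  fixes V :: "nat set" and E :: "(nat \<times> nat) set"
  assumes "computable_graph V E"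
  shows "\<exists>V' E'. computable_graph V' E' \<and> graph_isomorphic V E V' E' \<and>
    computable_set (isolated_vertices V' E')"
proof -
  have G: "nat_graph V E" and E: "computable_rel E"
    using assms by (auto simp: computable_graph_def)
  then have sym: "sym E" and irrefl: "irrefl E" by (auto simp: nat_graph_def)
  obtain b K where K: "computable_set K" and b: "bij_betw b (isolated_vertices V E) K"
    by (rule bij_betw_computable_set)
  \<comment> \<open>The codes of pairs \<open>(k, 0)\<close> with \<open>k\<close> in
    \<open>K\<close> are the copy vertices for the empty relation, so
    \<open>computable_copy_vertices\<close> also decides the isolated ones.\<close>
  have "isolated_vertices (copy_vertices E K) (copy_edges E) = copy_vertices {} K"
    unfolding isolated_copy[OF sym]
    by (auto elim: copy_vertices_cases simp: least_neighbour_def)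
  moreover have "computable_set (copy_vertices {} K)"
  proof (rule computable_copy_vertices[OF _ K])
    show "computable_rel {}"
      by (rule computable_relI)
        (use computable_pred_not[OF computable_pred_eq_0[OF computable_fun_0]] in simp)
  qed
  moreover have "computable_graph (copy_vertices E K) (copy_edges E)"
    unfolding computable_graph_def
    using nat_graph_copy[OF irrefl sym] computable_copy_vertices[OF E K] computable_copy_edges[OF E]
    by blast
  ultimately show ?thesis
    using copy_isomorphic[OF G b] by metis
qed

end
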